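(* Let $X_0\in\mathbb{R}^2$, $(M_1,M_2)\in\mathbb{Z}^2$ and the sequences $\{P_k\}$, $\{Q_k\}$, $\{F_k\}$, $\{G_k\}$ be as in the context. Suppose that $\{\widehat P_k\}$ and $\{\widehat Q_k\}$ have linear growth with respect to the translation by $(M_1,M_2)$, and that the quantities $P^{\#}(X_0)$, $Q^{\#}(X_0)$ and $\delta$ are all real. Then $\{G_k\}$ converges in the $C^\infty$-topology, as $k\to\infty$, to the function $$G(x_1,x_2)=F_0(0,0)-\Delta_1x_1-\Delta_2x_2 .$$
   Context: Write $E(x)=\exp(ix)$. Let $p_1,p_2,q_1,q_2$ be integers with $q_1,q_2\geq 1$, let $X_0=2\pi(p_1/q_1,p_2/q_2)$, and let $(M_1,M_2)\in\mathbb{Z}^2$. Let $N=q_1q_2/\gcd(q_1,q_2)$ and let $\phi:\mathbb{Z}^2\to\mathbb{Z}/N$ be the homomorphism $$\phi(x_1,x_2)=\Big[\frac{p_1q_2x_1+p_2q_1x_2}{\gcd(q_1,q_2)}\Big].$$ It is assumed that $\phi(M_1,M_2)=0$. A sequence $\{R_k\}_{k\ge0}$ of functions $R_k:\mathbb{R}^2\to\mathbb{C}$ of the form $R_k(X)=\sum_{V\in\mathbb{Z}^2}\widehat R_k(V)E(X\cdot V)$, with $\widehat R_k:\mathbb{Z}^2\to\mathbb{Z}$, is said to be such that $\{\widehat R_k\}$ has linear growth (with respect to translation by $(M_1,M_2)$) if $\widehat R_0$ has finite support and there is a finitely supported function $\widehat R^{\#}:\mathbb{Z}^2\to\mathbb{Z}$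 with $$\widehat R_{k+1}(V)=\widehat R_k(V)+\widehat R^{\#}\big(V-k(M_1,M_2)\big)\qquad (V\in\mathbb{Z}^2,\ k=0,1,2,\ldots).$$ In this case put $R^{\#}(X)=\sum_{V\in\mathbb{Z}^2}\widehat R^{\#}(V)E(X\cdot V)$. This applies to $R=P$ and $R=Q$, giving $P^{\#}$ and $Q^{\#}$. Define $$F_k(X)=\mathrm{Im}\big(P_k(X+X_0)\,\overline{Q_k(X+X_0)}\big)\ (k\ge 0),\qquad G_k(X)=F_k(Xk^{-2})\ (k\ge1).$$ With $\partial_j$ the partial derivative with respect to $x_j$, define $$\delta=\det\begin{bmatrix}P_0(X_0)&P^{\#}(X_0)\\ Q_0(X_0)&Q^{\#}(X_0)\end{bmatrix},\qquad \delta_j=\det\begin{bmatrix}P^{\#}(X_0)&\partial_jP^{\#}(X_0)\\ Q^{\#}(X_0)&\partial_jQ^{\#}(X_0)\end{bmatrix},\qquad \Delta_j=\frac{M_j\delta}{2}+\mathrm{Im}(\delta_j),\quad j=1,2.$$ Convergence in the $C^\infty$-topology means that each partial derivative (of every order, including order $0$) of $G_k$ converges uniformly on compact subsets of $\mathbb{R}^2$ to the corresponding partial derivative of $G$. *)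

theory Defs
  imports "HOL-Analysis.Analysis"
begin

definition E :: "real \<Rightarrow> complex" where
  "E x = exp (\<i> * complex_of_real x)"

definition of_lattice :: "int ^ 'n \<Rightarrow> real ^ 'n" where
  "of_lattice V = (\<chi> i. real_of_int (V $ i))"

text \<open>The function with Fourier coefficients \<open>c\<close>. It is only used for finitely supported \<open>c\<close>,
  where the sum below is a finite one.\<close>

definition trig_poly :: "(int ^ 'n::finite \<Rightarrow> int) \<Rightarrow> real ^ 'n \<Rightarrow> complex" where
  "trig_poly c X = (\<Sum>\<^sub>\<infinity>V. of_int (c V) * E (X \<bullet> of_lattice V))"

text \<open>The group of integers modulo \<open>N\<close> is represented by the residues from \<open>0\<close> to \<open>N - 1\<close>.
  Both divisions by the gcd are exact.\<close>

definition modulus_N :: "int \<Rightarrow> int \<Rightarrow> int" where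
  "modulus_N q1 q2 = (q1 * q2) div gcd q1 q2"

definition phi :: "int \<Rightarrow> int \<Rightarrow> int \<Rightarrow> int \<Rightarrow> int ^ 2 \<Rightarrow> int" where
  "phi p1 p2 q1 q2 x =
     ((p1 * q2 * x $ 1 + p2 * q1 * x $ 2) div gcd q1 q2) mod modulus_N q1 q2"

definition linear_growth_by ::
    "int ^ 'n \<Rightarrow> (nat \<Rightarrow> int ^ 'n \<Rightarrow> int) \<Rightarrow> (int ^ 'n \<Rightarrow> int) \<Rightarrow> bool" where
  "linear_growth_by M R S \<longleftrightarrow>
     finite {V. R 0 V \<noteq> 0} \<and> finite {V. S V \<noteq> 0} \<and>
     (\<forall>k V. R (Suc k) V = R k V + S (V - int k *s M))"

definition linear_growth :: "int ^ 'n \<Rightarrow> (nat \<Rightarrow> int ^ 'n \<Rightarrow> int) \<Rightarrow> bool" where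
  "linear_growth M R \<longleftrightarrow> (\<exists>S. linear_growth_by M R S)"

definition sharp :: "int ^ 'n \<Rightarrow> (nat \<Rightarrow> int ^ 'n \<Rightarrow> int) \<Rightarrow> int ^ 'n \<Rightarrow> int" where
  "sharp M R = (THE S. linear_growth_by M R S)"

lemma linear_growth_by_unique:
  assumes "linear_growth_by M R S" "linear_growth_by M R S'"
  shows "S = S'"
proof
  fix V
  have "R (Suc 0) V = R 0 V + S (V - int 0 *s M)" "R (Suc 0) V = R 0 V + S' (V - int 0 *s M)"
    using assms unfolding linear_growth_by_def by blast+
  then show "S V = S' V" by simp
qed

lemma linear_growth_by_sharp:
  assumes "linear_growth M R"
  shows "linear_growth_by M R (sharp M R)"
  using assms linear_growth_by_unique unfolding linear_growth_def sharp_def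
  by (metis theI)

definition partial :: "'n \<Rightarrow> (real ^ 'n::finite \<Rightarrow> 'b::real_normed_vector) \<Rightarrow> real ^ 'n \<Rightarrow> 'b" where
  "partial j f X = vector_derivative (\<lambda>t. f (X + t *\<^sub>R axis j 1)) (at 0)"

text \<open>A list \<open>[j1, ..., jm]\<close> of coordinate indices encodes the iterated (mixed) partial derivative
  of order \<open>m\<close> with respect to these coordinates; the empty list gives the function itself.\<close>

definition iter_partial ::
    "'n list \<Rightarrow> (real ^ 'n::finite \<Rightarrow> 'b::real_normed_vector) \<Rightarrow> real ^ 'n \<Rightarrow> 'b" where
  "iter_partial js f = foldr partial js f"

definition smooth :: "(real ^ 'n::finite \<Rightarrow> 'b::real_normed_vector) \<Rightarrow> bool" where
  "smooth f \<longleftrightarrow>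
     (\<forall>js. continuous_on UNIV (iter_partial js f) \<and>
       (\<forall>j X. (\<lambda>t. iter_partial js f (X + t *\<^sub>R axis j 1)) differentiable (at 0)))"

text \<open>Since \<open>partial\<close> is a total operator, smoothness of all functions involved is required
  explicitly, so that the derivatives being compared are genuine ones.\<close>

definition converges_Cinf ::
    "(nat \<Rightarrow> real ^ 'n::finite \<Rightarrow> 'b::real_normed_vector) \<Rightarrow> (real ^ 'n \<Rightarrow> 'b) \<Rightarrow> bool" where
  "converges_Cinf f g \<longleftrightarrow>
     (\<forall>k. smooth (f k)) \<and> smooth g \<and>
     (\<forall>js K. compact K \<longrightarrow>
       uniform_limit K (\<lambda>k. iter_partial js (f k)) (iter_partial js g) sequentially)"

definition F_seq ::
    "(nat \<Rightarrow> int ^ 2 \<Rightarrow> int) \<Rightarrow> (nat \<Rightarrow> int ^ 2 \<Rightarrow> int) \<Rightarrow> real ^ 2 \<Rightarrow> nat \<Rightarrow> real ^ 2 \<Rightarrow> real" where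
  "F_seq P Q X0 k X = Im (trig_poly (P k) (X + X0) * cnj (trig_poly (Q k) (X + X0)))"

definition G_seq ::
    "(nat \<Rightarrow> int ^ 2 \<Rightarrow> int) \<Rightarrow> (nat \<Rightarrow> int ^ 2 \<Rightarrow> int) \<Rightarrow> real ^ 2 \<Rightarrow> nat \<Rightarrow> real ^ 2 \<Rightarrow> real" where
  "G_seq P Q X0 k X = F_seq P Q X0 k ((1 / (real k)\<^sup>2) *\<^sub>R X)"

definition delta ::
    "int ^ 2 \<Rightarrow> (nat \<Rightarrow> int ^ 2 \<Rightarrow> int) \<Rightarrow> (nat \<Rightarrow> int ^ 2 \<Rightarrow> int) \<Rightarrow> real ^ 2 \<Rightarrow> complex" where
  "delta M P Q X0 = det (vector
     [vector [trig_poly (P 0) X0, trig_poly (sharp M P) X0],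
      vector [trig_poly (Q 0) X0, trig_poly (sharp M Q) X0]] :: complex ^ 2 ^ 2)"

definition delta_part ::
    "int ^ 2 \<Rightarrow> (nat \<Rightarrow> int ^ 2 \<Rightarrow> int) \<Rightarrow> (nat \<Rightarrow> int ^ 2 \<Rightarrow> int) \<Rightarrow> real ^ 2 \<Rightarrow> 2 \<Rightarrow> complex" where
  "delta_part M P Q X0 j = det (vector
     [vector [trig_poly (sharp M P) X0, partial j (trig_poly (sharp M P)) X0],
      vector [trig_poly (sharp M Q) X0, partial j (trig_poly (sharp M Q)) X0]] :: complex ^ 2 ^ 2)"

text \<open>\<open>Delta\<close> is only used when \<open>delta\<close> is real; \<open>Re\<close> then merely changes its type.\<close>

definition Delta ::
    "int ^ 2 \<Rightarrow> (nat \<Rightarrow> int ^ 2 \<Rightarrow> int) \<Rightarrow> (nat \<Rightarrow> int ^ 2 \<Rightarrow> int) \<Rightarrow> real ^ 2 \<Rightarrow> 2 \<Rightarrow> real" where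
  "Delta M P Q X0 j =
     real_of_int (M $ j) * Re (delta M P Q X0) / 2 + Im (delta_part M P Q X0 j)"

end

theory Submission
  imports Defs
begin

text \<open>Linear growth sums to \<open>P\<^sub>k = P\<^sub>0 + s\<^sub>k P\<^sup>#\<close> with \<open>s\<^sub>k(X) = \<Sum>l<k. E(l X \<bullet> M)\<close>, and likewise for
  \<open>Q\<close>. The condition \<open>\<phi>(M) = 0\<close> says that \<open>X\<^sub>0 \<bullet> M\<close> is a multiple of \<open>2 \<pi>\<close>, so \<open>s\<^sub>k(X + X\<^sub>0) = s\<^sub>k(X)\<close>.
  At the rescaled point \<open>X k\<^sup>-\<^sup>2\<close> the phases \<open>l X \<bullet> M k\<^sup>-\<^sup>2\<close> are of size \<open>1/k\<close>, and expanding \<open>E\<close> to first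
  order gives \<open>s\<^sub>k = k + \<i> (X \<bullet> M)/2 + O(1/k)\<close> (\<open>phase_sum_error\<close>). Inserting this into
  \<open>Im ((P\<^sub>0 + s\<^sub>k P\<^sup>#) cnj (Q\<^sub>0 + s\<^sub>k Q\<^sup>#))\<close> produces terms of order \<open>k\<^sup>2\<close>, \<open>k\<close> and \<open>1\<close>. The coefficients
  of \<open>k\<^sup>2\<close> and \<open>k\<close> vanish at \<open>X\<^sub>0\<close> because \<open>P\<^sup>#(X\<^sub>0)\<close>, \<open>Q\<^sup>#(X\<^sub>0)\<close> and \<open>\<delta>\<close> are real. Moving away from
  \<open>X\<^sub>0\<close> by \<open>X k\<^sup>-\<^sup>2\<close>, the first contributes its derivative, which yields \<open>- Im \<delta>\<^sub>j\<close>, and the second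
  contributes \<open>O(1/k)\<close>. The term \<open>\<i> (X \<bullet> M)/2\<close> in \<open>s\<^sub>k\<close> yields \<open>- M\<^sub>j \<delta>/2\<close>. This is
  \<open>tendsto_rescaled_Im_product\<close>; taken jointly in \<open>k\<close> and \<open>X\<close>, it is locally uniform convergence.

  Derivatives need no separate asymptotics. By Landau's interpolation principle, \<open>converges_CinfI\<close>,
  locally uniform convergence forces convergence of all derivatives once those of order at least 2
  are locally bounded uniformly in \<open>k\<close>. For these bounds a crude count suffices
  (\<open>G_seq_higher_partials_bounded\<close>): \<open>G\<^sub>k\<close> is an exponential sum whose coefficients have total mass
  \<open>O(k\<^sup>2)\<close> and whose frequencies are \<open>O(k) k\<^sup>-\<^sup>2 = O(1/k)\<close>, so its derivatives of order \<open>m\<close> are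
  \<open>O(k\<^sup>2 k\<^sup>-\<^sup>m)\<close>.\<close>

section \<open>Convergence of derivatives from bounds on second derivatives\<close>

lemma partial_eqI:
  "((\<lambda>t. f (X + t *\<^sub>R axis j 1)) has_vector_derivative d) (at 0) \<Longrightarrow> partial j f X = d"
  unfolding partial_def by (rule vector_derivative_at)

lemma iter_partial_Nil [simp]: "iter_partial [] f = f"
  by (simp add: iter_partial_def)

lemma iter_partial_Cons [simp]: "iter_partial (j # js) f = partial j (iter_partial js f)"
  by (simp add: iter_partial_def)

text \<open>Smoothness only provides the derivative along a coordinate line at parameter 0; moving the base
  point along the line gives it at every parameter.\<close>

lemma smooth_line_derivative:
  assumes "smooth f"
  shows "((\<lambda>t. iter_partial js f (X + t *\<^sub>R axis j 1)) has_vector_derivative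
           iter_partial (j # js) f (X + s *\<^sub>R axis j 1)) (at s within A)"
proof -
  let ?g = "\<lambda>t. iter_partial js f ((X + s *\<^sub>R axis j 1) + t *\<^sub>R axis j 1)"
  have "?g differentiable (at 0)"
    using assms unfolding smooth_def by blast
  then have "(?g has_vector_derivative iter_partial (j # js) f (X + s *\<^sub>R axis j 1)) (at (s - s))"
    by (simp add: partial_def vector_derivative_works[symmetric])
  moreover have "((\<lambda>t. t - s) has_vector_derivative 1) (at s)"
    by (auto intro!: derivative_eq_intros)
  ultimately have "(?g \<circ> (\<lambda>t. t - s) has_vector_derivative
      1 *\<^sub>R iter_partial (j # js) f (X + s *\<^sub>R axis j 1)) (at s)"
    by (intro vector_diff_chain_at) auto
  moreover have "?g \<circ> (\<lambda>t. t - s) = (\<lambda>t. iter_partial js f (X + t *\<^sub>R axis j 1))"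
    by (auto simp: algebra_simps)
  ultimately show ?thesis
    by (simp add: has_vector_derivative_at_within)
qed

text \<open>Applying the mean value inequality twice bounds the error of a first-order expansion in a
  coordinate direction by the second derivative in that direction.\<close>

lemma difference_quotient_error:
  assumes f: "smooth f"
    and B: "\<And>t. 0 \<le> t \<Longrightarrow> t \<le> h \<Longrightarrow> norm (iter_partial (j # j # js) f (X + t *\<^sub>R axis j 1)) \<le> B"
    and h: "0 \<le> h"
  shows "norm (iter_partial js f (X + h *\<^sub>R axis j 1) - iter_partial js f X
           - h *\<^sub>R iter_partial (j # js) f X) \<le> h * (h * B)"
proof -
  let ?d = "\<lambda>t. iter_partial (j # js) f (X + t *\<^sub>R axis j 1)"
  have lip: "norm (?d t - ?d 0) \<le> h * B" if "t \<in> {0..h}" for t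
  proof -
    have "norm (?d t - ?d 0) \<le> B * norm (t - 0)"
    proof (rule differentiable_bound[where S = "{0..h}"])
      fix s :: real assume "s \<in> {0..h}"
      then show "(?d has_derivative (\<lambda>u. u *\<^sub>R iter_partial (j # j # js) f (X + s *\<^sub>R axis j 1)))
          (at s within {0..h})"
        and "onorm (\<lambda>u. u *\<^sub>R iter_partial (j # j # js) f (X + s *\<^sub>R axis j 1)) \<le> B"
        using smooth_line_derivative[OF f, of "j # js" X j s "{0..h}"] B[of s]
        by (auto simp: has_vector_derivative_def onorm_scaleR_left onorm_id bounded_linear_ident)
    qed (use that h in auto)
    also have "\<dots> \<le> B * h"
      using that order_trans[OF norm_ge_zero B[of 0]] h by (intro mult_left_mono) auto
    finally show ?thesis by (simp add: mult.commute)
  qed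
  show ?thesis
    using vector_differentiable_bound_linearization[where a = 0 and b = h and S = "{0..h}" and ?x0.0 = 0
        and f = "\<lambda>t. iter_partial js f (X + t *\<^sub>R axis j 1)" and f' = ?d and B = "h * B",
        OF smooth_line_derivative[OF f] _ lip] h
    by (simp add: closed_segment_eq_real_ivl)
qed

text \<open>Landau's interpolation: if \<open>f\<^sub>k - g\<close> is small and its second derivatives in direction \<open>j\<close> are
  bounded by \<open>B\<close>, then a difference quotient of step \<open>h\<close> approximates the first derivative up to
  \<open>h B\<close>, and for fixed \<open>h\<close> the quotient tends to 0 as \<open>k \<rightarrow> \<infinity>\<close>. Induction on the order applies this to
  the iterated partial derivatives, so bounds on the orders from 2 onwards are enough.\<close>

lemma converges_CinfI:
  fixes f :: "nat \<Rightarrow> real ^ 'n::finite \<Rightarrow> 'b::real_normed_vector"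
  assumes f: "\<And>k. smooth (f k)" and g: "smooth g"
    and conv: "\<And>K. compact K \<Longrightarrow> uniform_limit K f g sequentially"
    and bound: "\<And>js K. length js \<ge> 2 \<Longrightarrow> compact K \<Longrightarrow>
                  \<exists>B. \<forall>k. \<forall>X\<in>K. norm (iter_partial js (f k) X) \<le> B"
  shows "converges_Cinf f g"
proof -
  have "\<forall>K. compact K \<longrightarrow>
      uniform_limit K (\<lambda>k. iter_partial js (f k)) (iter_partial js g) sequentially" for js
  proof (induction js)
    case Nil
    then show ?case by (simp add: conv)
  next
    case (Cons j js)
    show ?case
    proof (intro allI impI uniform_limitI)
      fix K :: "(real ^ 'n) set" and e :: real
      assume K: "compact K" and e: "0 < e"
      \<comment> \<open>\<open>L\<close> contains the segments along which the difference quotients of step at most 1 are taken.\<close>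
      define L where "L = (\<lambda>(X, t). X + t *\<^sub>R (axis j 1 :: real ^ 'n)) ` (K \<times> {0..1})"
      have L: "compact L"
        unfolding L_def case_prod_beta
        by (intro compact_continuous_image continuous_intros compact_Times K compact_Icc)
      have in_L: "X + t *\<^sub>R axis j 1 \<in> L" if "X \<in> K" "0 \<le> t" "t \<le> 1" for X t
        unfolding L_def using that by force
      obtain B1 where B1: "\<And>k X. X \<in> L \<Longrightarrow> norm (iter_partial (j # j # js) (f k) X) \<le> B1"
        using bound[of "j # j # js" L] L by fastforce
      have "continuous_on L (iter_partial (j # j # js) g)"
        using g continuous_on_subset unfolding smooth_def by blast
      then have "bounded (iter_partial (j # j # js) g ` L)"
        using L compact_continuous_image compact_imp_bounded by blast
      then obtain B2 where B2: "\<And>X. X \<in> L \<Longrightarrow> norm (iter_partial (j # j # js) g X) \<le> B2"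
        unfolding bounded_iff by blast
      define B where "B = max 1 (max B1 B2)"
      have FB: "norm (iter_partial (j # j # js) (f k) X) \<le> B"
        and GB: "norm (iter_partial (j # j # js) g X) \<le> B" if "X \<in> L" for k X
        using B1[OF that, of k] B2[OF that] unfolding B_def by linarith+
      \<comment> \<open>The step makes each of the two second-order errors at most \<open>e/4\<close>.\<close>
      define h where "h = min 1 (e / (4 * B))"
      have h: "0 < h" "h \<le> 1" "h * B \<le> e / 4" and B: "B \<ge> 1"
        using e by (auto simp: h_def B_def min_def field_simps)
      have "uniform_limit L (\<lambda>k. iter_partial js (f k)) (iter_partial js g) sequentially"
        using Cons L by blast
      then have "\<forall>\<^sub>F k in sequentially. \<forall>X\<in>L. dist (iter_partial js (f k) X) (iter_partial js g X) < h * e / 8"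
        using e h by (auto dest: uniform_limitD[where e = "h * e / 8"])
      then show "\<forall>\<^sub>F k in sequentially. \<forall>X\<in>K.
          dist (iter_partial (j # js) (f k) X) (iter_partial (j # js) g X) < e"
      proof eventually_elim
        case (elim k)
        show ?case
        proof
          fix X assume X: "X \<in> K"
          let ?Y = "X + h *\<^sub>R axis j 1"
          let ?F = "iter_partial js (f k)" and ?G = "iter_partial js g"
          let ?F' = "iter_partial (j # js) (f k) X" and ?G' = "iter_partial (j # js) g X"
          have rF: "norm (?F ?Y - ?F X - h *\<^sub>R ?F') \<le> h * (h * B)"
            by (rule difference_quotient_error[OF f])
               (use h X in_L FB in auto)
          have rG: "norm (?G ?Y - ?G X - h *\<^sub>R ?G') \<le> h * (h * B)"
            by (rule difference_quotient_error[OF g])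
               (use h X in_L GB in auto)
          have dY: "norm (?F ?Y - ?G ?Y) < h * e / 8"
            using elim in_L[OF X, of h] h by (simp add: dist_norm)
          have dX: "norm (?F X - ?G X) < h * e / 8"
            using elim in_L[OF X, of 0] by (simp add: dist_norm)
          have "norm (h *\<^sub>R (?F' - ?G')) = norm ((?F ?Y - ?G ?Y) - (?F X - ?G X)
              - (?F ?Y - ?F X - h *\<^sub>R ?F') + (?G ?Y - ?G X - h *\<^sub>R ?G'))"
            by (simp add: algebra_simps)
          also have "\<dots> \<le> norm (?F ?Y - ?G ?Y) + norm (?F X - ?G X)
              + norm (?F ?Y - ?F X - h *\<^sub>R ?F') + norm (?G ?Y - ?G X - h *\<^sub>R ?G')"
            by (intro order_trans[OF norm_triangle_ineq] order_trans[OF norm_triangle_ineq4] add_mono order_refl)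
          also have "\<dots> < h * e / 8 + h * e / 8 + h * (h * B) + h * (h * B)"
            by (intro add_less_le_mono add_strict_mono rF rG dX dY)
          also have "\<dots> \<le> h * e / 8 + h * e / 8 + h * (e / 4) + h * (e / 4)"
            using h by (intro add_mono mult_left_mono) auto
          also have "\<dots> = h * (3 * e / 4)" by (simp add: field_simps)
          finally have "norm (?F' - ?G') < 3 * e / 4"
            using h by simp
          then show "dist ?F' ?G' < e" using e by (simp add: dist_norm)
        qed
      qed
    qed
  qed
  then show ?thesis
    unfolding converges_Cinf_def using f g by blast
qed

lemma smooth_affine:
  fixes b :: "real ^ 'n::finite"
  shows "smooth (\<lambda>X. a + b \<bullet> X :: real)"
proof -
  have part: "partial j (\<lambda>X. a + b \<bullet> X :: real) = (\<lambda>X. b $ j + 0 \<bullet> X)" for j a and b :: "real ^ 'n"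
  proof
    fix X :: "real ^ 'n"
    have "((\<lambda>t. a + b \<bullet> (X + t *\<^sub>R axis j 1)) has_vector_derivative b $ j) (at 0)"
      by (auto intro!: derivative_eq_intros
          simp: has_real_derivative_iff_has_vector_derivative[symmetric] inner_axis inner_add_right)
    then show "partial j (\<lambda>X. a + b \<bullet> X) X = b $ j + 0 \<bullet> X"
      using partial_eqI by simp
  qed
  have affine: "\<exists>a' b'. iter_partial js (\<lambda>X. a + b \<bullet> X) = (\<lambda>X. a' + b' \<bullet> X)" for js
  proof (induction js)
    case Nil
    show ?case by (intro exI) simp
  next
    case (Cons j js)
    then obtain a' b' where "iter_partial js (\<lambda>X. a + b \<bullet> X) = (\<lambda>X. a' + b' \<bullet> X)"
      by blast
    then show ?case unfolding iter_partial_Cons by (simp only: part) blast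
  qed
  show ?thesis
    unfolding smooth_def
  proof (intro allI conjI)
    fix js and j :: 'n and X :: "real ^ 'n"
    obtain a' b' where eq: "iter_partial js (\<lambda>X. a + b \<bullet> X) = (\<lambda>X. a' + b' \<bullet> X)"
      using affine by blast
    show "continuous_on UNIV (iter_partial js (\<lambda>X. a + b \<bullet> X))"
      unfolding eq by (intro continuous_intros)
    show "(\<lambda>t. iter_partial js (\<lambda>X. a + b \<bullet> X) (X + t *\<^sub>R axis j 1)) differentiable at 0"
      unfolding eq by (simp add: inner_add_right)
  qed
qed

text \<open>Letting the argument vary together with the index turns locally uniform convergence into an
  ordinary limit along a product filter, where the usual limit rules apply. Compactness recovers the
  uniform statement from finitely many neighbourhoods.\<close>

lemma uniform_limit_of_joint_limits:
  fixes f :: "nat \<Rightarrow> 'a::metric_space \<Rightarrow> 'b::metric_space"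
  assumes K: "compact K" and g: "\<And>x. isCont g x"
    and lim: "\<And>x. ((\<lambda>(k, y). f k y) \<longlongrightarrow> g x) (sequentially \<times>\<^sub>F nhds x)"
  shows "uniform_limit K f g sequentially"
proof (rule uniform_limitI)
  fix e :: real assume e: "0 < e"
  have nbhd: "\<exists>U. open U \<and> x \<in> U \<and> (\<forall>\<^sub>F k in sequentially. \<forall>y\<in>U. dist (f k y) (g y) < e)" for x
  proof -
    have "\<forall>\<^sub>F z in sequentially \<times>\<^sub>F nhds x. dist (case z of (k, y) \<Rightarrow> f k y) (g x) < e / 2"
      using tendstoD[OF lim[of x], of "e / 2"] e by simp
    then obtain A B where A: "eventually A sequentially" and B: "eventually B (nhds x)"
      and AB: "\<And>k y. A k \<Longrightarrow> B y \<Longrightarrow> dist (f k y) (g x) < e / 2"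
      unfolding eventually_prod_filter by auto
    have "\<forall>\<^sub>F y in nhds x. dist (g y) (g x) < e / 2"
      using g[of x] e unfolding continuous_at tendsto_at_iff_tendsto_nhds
      by (auto dest: tendstoD[where e = "e / 2"])
    with B have "\<forall>\<^sub>F y in nhds x. B y \<and> dist (g y) (g x) < e / 2"
      by (rule eventually_conj)
    then obtain U where U: "open U" "x \<in> U" "\<And>y. y \<in> U \<Longrightarrow> B y \<and> dist (g y) (g x) < e / 2"
      unfolding eventually_nhds by blast
    have "dist (f k y) (g y) < e" if "A k" "y \<in> U" for k y
      using AB[OF that(1), of y] U(3)[OF that(2)] dist_triangle_half_l by blast
    then show ?thesis
      using U A by (intro exI[of _ U]) (auto elim!: eventually_mono)
  qed
  have "\<exists>U. \<forall>x. open (U x) \<and> x \<in> U x \<and> (\<forall>\<^sub>F k in sequentially. \<forall>y\<in>U x. dist (f k y) (g y) < e)"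
    by (rule choice) (rule allI, rule nbhd)
  then obtain U where U: "\<And>x. open (U x)" "\<And>x. x \<in> U x"
    and ev: "\<And>x. \<forall>\<^sub>F k in sequentially. \<forall>y\<in>U x. dist (f k y) (g y) < e"
    by blast
  obtain C where C: "finite C" "K \<subseteq> (\<Union>x\<in>C. U x)"
    by (rule compactE_image[OF K, of K U]) (use U in auto)
  have "\<forall>\<^sub>F k in sequentially. \<forall>x\<in>C. \<forall>y\<in>U x. dist (f k y) (g y) < e"
    using C(1) ev by (intro eventually_ball_finite) auto
  then show "\<forall>\<^sub>F k in sequentially. \<forall>x\<in>K. dist (f k x) (g x) < e"
    by eventually_elim (use C in blast)
qed

section \<open>Finite exponential sums\<close>

lemma E_add: "E (x + y) = E x * E y"
  by (simp add: E_def distrib_left exp_add)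

lemma norm_E [simp]: "norm (E x) = 1"
  by (simp add: E_def)

lemma cnj_E: "cnj (E x) = E (- x)"
  by (simp add: E_def exp_cnj)

lemma E_integer_multiple_2pi: "E (2 * pi * of_int n) = 1"
  unfolding E_def using exp_integer_2pi[of "of_int n"] by (simp add: mult.commute mult.left_commute)

lemma E_inner_has_derivative:
  "((\<lambda>X. E (X \<bullet> w)) has_derivative (\<lambda>h. \<i> * of_real (h \<bullet> w) * E (X \<bullet> w))) (at X)"
proof -
  have "((\<lambda>X. exp (\<i> * complex_of_real (X \<bullet> w))) has_derivative
      (\<lambda>h. exp (\<i> * of_real (X \<bullet> w)) * (\<i> * of_real (h \<bullet> w)))) (at X)"
    by (rule has_derivative_compose[OF _ DERIV_exp[unfolded has_field_derivative_def]])
       (auto intro!: derivative_eq_intros has_derivative_of_real)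
  then show ?thesis by (simp add: E_def mult_ac)
qed

lemma partial_Im_exp_sum:
  fixes w :: "'i \<Rightarrow> real ^ 'n::finite"
  shows "((\<lambda>t. Im (\<Sum>i\<in>I. c i * E ((X + t *\<^sub>R axis j 1) \<bullet> w i))) has_vector_derivative
      Im (\<Sum>i\<in>I. (c i * (\<i> * of_real (w i $ j))) * E (X \<bullet> w i))) (at 0)"
proof -
  have "((\<lambda>t. E ((X + t *\<^sub>R axis j 1) \<bullet> w i)) has_derivative
      (\<lambda>h. \<i> * of_real ((h *\<^sub>R axis j 1) \<bullet> w i) * E ((X + 0 *\<^sub>R axis j 1) \<bullet> w i))) (at 0)" for i
    by (rule has_derivative_compose[OF _ E_inner_has_derivative, of "\<lambda>t. X + t *\<^sub>R axis j 1"])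
       (auto intro!: derivative_eq_intros)
  note d = this
  show ?thesis
    unfolding has_vector_derivative_def
    by (rule has_derivative_eq_rhs, rule has_derivative_Im, rule has_derivative_sum,
        rule has_derivative_mult_right, rule d)
       (auto simp: inner_axis' sum_distrib_left algebra_simps Im_sum)
qed

lemma iter_partial_Im_exp_sum:
  fixes w :: "'i \<Rightarrow> real ^ 'n::finite"
  shows "iter_partial js (\<lambda>X. Im (\<Sum>i\<in>I. c i * E (X \<bullet> w i))) =
    (\<lambda>X. Im (\<Sum>i\<in>I. (c i * (\<Prod>j\<leftarrow>js. \<i> * of_real (w i $ j))) * E (X \<bullet> w i)))"
proof (induction js)
  case Nil
  then show ?case by simp
next
  case (Cons j js)
  show ?case
    unfolding iter_partial_Cons Cons
    by (rule ext, rule trans, rule partial_eqI, rule partial_Im_exp_sum)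
       (simp add: mult_ac)
qed

lemma smooth_Im_exp_sum:
  fixes w :: "'i \<Rightarrow> real ^ 'n::finite"
  shows "smooth (\<lambda>X. Im (\<Sum>i\<in>I. c i * E (X \<bullet> w i)))"
  unfolding smooth_def iter_partial_Im_exp_sum
proof (intro allI conjI)
  fix js and j :: 'n and X :: "real ^ 'n"
  show "continuous_on UNIV (\<lambda>X. Im (\<Sum>i\<in>I. (c i * (\<Prod>j\<leftarrow>js. \<i> * of_real (w i $ j))) * E (X \<bullet> w i)))"
    unfolding E_def by (intro continuous_intros)
  show "(\<lambda>t. Im (\<Sum>i\<in>I. (c i * (\<Prod>j\<leftarrow>js. \<i> * of_real (w i $ j))) * E ((X + t *\<^sub>R axis j 1) \<bullet> w i)))
      differentiable at 0"
    by (rule differentiableI_vector, rule partial_Im_exp_sum)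
qed

lemma norm_iter_partial_Im_exp_sum_le:
  fixes w :: "'i \<Rightarrow> real ^ 'n::finite"
  assumes w: "\<And>i. i \<in> I \<Longrightarrow> norm (w i) \<le> b"
  shows "norm (iter_partial js (\<lambda>X. Im (\<Sum>i\<in>I. c i * E (X \<bullet> w i))) X)
           \<le> (\<Sum>i\<in>I. norm (c i)) * b ^ length js"
proof -
  have freq: "norm (\<Prod>j\<leftarrow>js. \<i> * complex_of_real (w i $ j)) \<le> b ^ length js" if "i \<in> I" for i
  proof (induction js)
    case Nil
    then show ?case by simp
  next
    case (Cons j js)
    have "\<bar>w i $ j\<bar> \<le> b"
      using component_le_norm_cart[of "w i" j] w[OF that] by simp
    then show ?case
      using Cons by (auto simp: norm_mult intro!: mult_mono)
  qed
  have "norm (iter_partial js (\<lambda>X. Im (\<Sum>i\<in>I. c i * E (X \<bullet> w i))) X)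
      \<le> norm (\<Sum>i\<in>I. (c i * (\<Prod>j\<leftarrow>js. \<i> * of_real (w i $ j))) * E (X \<bullet> w i))"
    unfolding iter_partial_Im_exp_sum real_norm_def by (rule abs_Im_le_cmod)
  also have "\<dots> \<le> (\<Sum>i\<in>I. norm (c i) * b ^ length js)"
    by (rule sum_norm_le) (auto simp: norm_mult intro!: mult_left_mono freq)
  finally show ?thesis by (simp add: sum_distrib_right)
qed

section \<open>Trigonometric polynomials and linear growth\<close>

lemma of_lattice_add: "of_lattice (V + W) = of_lattice V + of_lattice W"
  by (simp add: of_lattice_def vec_eq_iff)

lemma of_lattice_multiple: "of_lattice (int k *s M) = real k *\<^sub>R of_lattice M"
  by (simp add: of_lattice_def vec_eq_iff)

lemma trig_poly_eq_sum:
  assumes "finite A" "{V. c V \<noteq> 0} \<subseteq> A"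
  shows "trig_poly c X = (\<Sum>V\<in>A. of_int (c V) * E (X \<bullet> of_lattice V))"
proof -
  have "trig_poly c X = (\<Sum>\<^sub>\<infinity>V\<in>A. of_int (c V) * E (X \<bullet> of_lattice V))"
    unfolding trig_poly_def by (rule infsum_cong_neutral) (use assms in auto)
  then show ?thesis using assms by simp
qed

lemma trig_poly_add:
  assumes "finite {V. c V \<noteq> 0}" "finite {V. d V \<noteq> 0}"
  shows "trig_poly (\<lambda>V. c V + d V) X = trig_poly c X + trig_poly d X"
proof -
  let ?A = "{V. c V \<noteq> 0} \<union> {V. d V \<noteq> 0}"
  have A: "finite ?A" using assms by simp
  have "trig_poly c X = (\<Sum>V\<in>?A. of_int (c V) * E (X \<bullet> of_lattice V))"
    and "trig_poly d X = (\<Sum>V\<in>?A. of_int (d V) * E (X \<bullet> of_lattice V))"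
    and "trig_poly (\<lambda>V. c V + d V) X = (\<Sum>V\<in>?A. of_int (c V + d V) * E (X \<bullet> of_lattice V))"
    by (intro trig_poly_eq_sum[OF A]; force)+
  then show ?thesis
    by (simp add: sum.distrib distrib_right)
qed

text \<open>Translating the Fourier coefficients multiplies the function by a phase; this is what turns linear
  growth into a geometric sum of phases.\<close>

lemma trig_poly_translate:
  "trig_poly (\<lambda>V. c (V - U)) X = E (X \<bullet> of_lattice U) * trig_poly c X"
proof -
  have "trig_poly (\<lambda>V. c (V - U)) X =
      (\<Sum>\<^sub>\<infinity>V. of_int (c ((V + U) - U)) * E (X \<bullet> of_lattice (V + U)))"
    unfolding trig_poly_def
    by (rule infsum_reindex_bij_betw[symmetric, of "\<lambda>V. V + U"])
       (auto intro!: bij_betwI[of _ _ _ "\<lambda>V. V - U"])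
  also have "\<dots> = (\<Sum>\<^sub>\<infinity>V. E (X \<bullet> of_lattice U) * (of_int (c V) * E (X \<bullet> of_lattice V)))"
    by (rule infsum_cong) (simp add: of_lattice_add inner_add_right E_add mult_ac)
  also have "\<dots> = E (X \<bullet> of_lattice U) * trig_poly c X"
    unfolding trig_poly_def by (rule infsum_cmult_right')
  finally show ?thesis .
qed

lemma trig_poly_has_derivative:
  assumes "finite {V. c V \<noteq> 0}"
  obtains D where "(trig_poly c has_derivative D) (at X)"
proof -
  have "trig_poly c = (\<lambda>X. \<Sum>V | c V \<noteq> 0. of_int (c V) * E (X \<bullet> of_lattice V))"
    using trig_poly_eq_sum[OF assms order_refl] by auto
  then have "\<exists>D. (trig_poly c has_derivative D) (at X)"
    by (auto intro!: exI has_derivative_sum has_derivative_mult_right E_inner_has_derivative)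
  then show thesis using that by blast
qed

lemma finite_support_translate:
  fixes c :: "int ^ 'n \<Rightarrow> int"
  assumes "finite {V. c V \<noteq> 0}"
  shows "{V. c (V - U) \<noteq> 0} = (\<lambda>V. V + U) ` {V. c V \<noteq> 0}" "finite {V. c (V - U) \<noteq> 0}"
proof -
  show eq: "{V. c (V - U) \<noteq> 0} = (\<lambda>V. V + U) ` {V. c V \<noteq> 0}"
    by (auto simp: image_iff) (metis diff_add_cancel)
  show "finite {V. c (V - U) \<noteq> 0}" unfolding eq using assms by simp
qed

lemma linear_growth_finite_support:
  assumes "linear_growth_by M R S"
  shows "finite {V. R k V \<noteq> 0}"
proof (induction k)
  case 0
  then show ?case using assms by (simp add: linear_growth_by_def)
next
  case (Suc k)
  have "{V. R (Suc k) V \<noteq> 0} \<subseteq> {V. R k V \<noteq> 0} \<union> {V. S (V - int k *s M) \<noteq> 0}"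
    using assms by (auto simp: linear_growth_by_def)
  moreover have "finite {V. S (V - int k *s M) \<noteq> 0}"
    using assms by (intro finite_support_translate) (simp add: linear_growth_by_def)
  ultimately show ?case using Suc finite_subset by blast
qed

lemma trig_poly_linear_growth:
  assumes "linear_growth_by M R S"
  shows "trig_poly (R k) X =
    trig_poly (R 0) X + (\<Sum>l<k. E (real l * (X \<bullet> of_lattice M))) * trig_poly S X"
proof (induction k)
  case 0
  then show ?case by simp
next
  case (Suc k)
  have "R (Suc k) = (\<lambda>V. R k V + S (V - int k *s M))"
    using assms by (auto simp: linear_growth_by_def)
  then have "trig_poly (R (Suc k)) X = trig_poly (R k) X + trig_poly (\<lambda>V. S (V - int k *s M)) X"
    using assms linear_growth_finite_support[OF assms] finite_support_translate(2)[of S]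
    by (simp add: trig_poly_add linear_growth_by_def)
  then show ?case
    using Suc by (simp add: trig_poly_translate of_lattice_multiple distrib_right)
qed

text \<open>Step \<open>k\<close> of the recursion adds a copy of \<open>S\<close> translated by \<open>k M\<close>: its mass does not depend on \<open>k\<close>,
  and its support lies at distance \<open>O(k)\<close> from the origin.\<close>

lemma linear_growth_bounds:
  assumes "linear_growth_by M R S"
  obtains C where "C \<ge> 0"
    "\<And>k. (\<Sum>V | R k V \<noteq> 0. \<bar>real_of_int (R k V)\<bar>) \<le> C * real (Suc k)"
    "\<And>k V. R k V \<noteq> 0 \<Longrightarrow> norm (of_lattice V) \<le> C * real (Suc k)"
proof -
  let ?m = "\<lambda>c. \<Sum>V | c V \<noteq> 0. \<bar>real_of_int (c V)\<bar>"
  let ?A = "{V. R 0 V \<noteq> 0} \<union> {V. S V \<noteq> 0}"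
  \<comment> \<open>\<open>C1\<close> controls the mass, \<open>C2\<close> the radius of the support.\<close>
  define C1 where "C1 = ?m (R 0) + ?m S"
  define C2 where "C2 = (\<Sum>V\<in>?A. norm (of_lattice V)) + norm (of_lattice M)"
  have R0: "finite {V. R 0 V \<noteq> 0}" and S: "finite {V. S V \<noteq> 0}"
    and step: "\<And>k V. R (Suc k) V = R k V + S (V - int k *s M)"
    using assms by (auto simp: linear_growth_by_def)
  have m_nonneg: "0 \<le> ?m c" for c :: "int ^ 'n \<Rightarrow> int"
    by (simp add: sum_nonneg)
  have C2_ge: "norm (of_lattice V) \<le> C2 - norm (of_lattice M)" if "V \<in> ?A" for V
    unfolding C2_def using member_le_sum[OF that, of "\<lambda>V. norm (of_lattice V)"] R0 S by simp
  have C: "C1 \<ge> 0" "C2 \<ge> 0"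
    by (auto simp: C1_def C2_def intro!: add_nonneg_nonneg sum_nonneg)
  have mass: "?m (R k) \<le> C1 * real (Suc k)" for k
  proof (induction k)
    case 0
    then show ?case using m_nonneg[of S] by (simp add: C1_def)
  next
    case (Suc k)
    let ?T = "\<lambda>V. S (V - int k *s M)"
    let ?B = "{V. R k V \<noteq> 0} \<union> {V. ?T V \<noteq> 0}"
    have T: "finite {V. ?T V \<noteq> 0}" and Tim: "{V. ?T V \<noteq> 0} = (\<lambda>V. V + int k *s M) ` {V. S V \<noteq> 0}"
      using finite_support_translate[OF S] by auto
    have B: "finite ?B" using T linear_growth_finite_support[OF assms] by simp
    have "?m (R (Suc k)) \<le> (\<Sum>V\<in>?B. \<bar>real_of_int (R k V)\<bar> + \<bar>real_of_int (?T V)\<bar>)"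
    proof -
      have "?m (R (Suc k)) \<le> (\<Sum>V | R (Suc k) V \<noteq> 0. \<bar>real_of_int (R k V)\<bar> + \<bar>real_of_int (?T V)\<bar>)"
        by (rule sum_mono) (simp add: step)
      also have "\<dots> \<le> (\<Sum>V\<in>?B. \<bar>real_of_int (R k V)\<bar> + \<bar>real_of_int (?T V)\<bar>)"
        by (rule sum_mono2[OF B]) (auto simp: step)
      finally show ?thesis .
    qed
    also have "\<dots> = (\<Sum>V\<in>?B. \<bar>real_of_int (R k V)\<bar>) + (\<Sum>V\<in>?B. \<bar>real_of_int (?T V)\<bar>)"
      by (rule sum.distrib)
    also have "(\<Sum>V\<in>?B. \<bar>real_of_int (R k V)\<bar>) = ?m (R k)"
      by (rule sum.mono_neutral_right[OF B]) auto
    also have "(\<Sum>V\<in>?B. \<bar>real_of_int (?T V)\<bar>) = ?m ?T"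
      by (rule sum.mono_neutral_right[OF B]) auto
    also have "?m ?T = ?m S"
      unfolding Tim by (subst sum.reindex) (auto simp: inj_on_def)
    also have "?m (R k) + ?m S \<le> C1 * real (Suc k) + C1"
      using Suc m_nonneg[of "R 0"] unfolding C1_def by linarith
    also have "\<dots> = C1 * real (Suc (Suc k))" by (simp add: algebra_simps)
    finally show ?case .
  qed
  have freq: "norm (of_lattice V) \<le> C2 * real (Suc k)" if "R k V \<noteq> 0" for k V
    using that
  proof (induction k arbitrary: V)
    case 0
    then have "norm (of_lattice V) \<le> C2 - norm (of_lattice M)" using C2_ge[of V] by blast
    also have "\<dots> \<le> C2 * real (Suc 0)" by simp
    finally show ?case .
  next
    case (Suc k)
    show ?case
    proof (cases "R k V = 0")
      case False
      then show ?thesis using Suc.IH[of V] C by (simp add: distrib_left)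
    next
      case True
      define W where "W = V - int k *s M"
      have "S W \<noteq> 0" using Suc.prems True step by (simp add: W_def)
      have W_le: "norm (of_lattice W) \<le> C2"
        by (rule order_trans[OF C2_ge]) (use \<open>S W \<noteq> 0\<close> in auto)
      have M_le: "norm (of_lattice M) \<le> C2"
        by (simp add: C2_def sum_nonneg)
      have "of_lattice V = of_lattice W + real k *\<^sub>R of_lattice M"
        unfolding of_lattice_multiple[symmetric] of_lattice_add[symmetric] by (simp add: W_def)
      then have "norm (of_lattice V) \<le> norm (of_lattice W) + real k * norm (of_lattice M)"
        using norm_triangle_ineq[of "of_lattice W" "real k *\<^sub>R of_lattice M"] by simp
      also have "\<dots> \<le> C2 + real k * C2"
        by (intro add_mono mult_left_mono W_le M_le) simp
      also have "\<dots> \<le> C2 * real (Suc (Suc k))" using C by (simp add: algebra_simps)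
      finally show ?thesis .
    qed
  qed
  show thesis
  proof (rule that[of "C1 + C2"])
    show "0 \<le> C1 + C2" using C by simp
    show "?m (R k) \<le> (C1 + C2) * real (Suc k)" for k
      using mass[of k] C by (simp add: distrib_right add_increasing2)
    show "norm (of_lattice V) \<le> (C1 + C2) * real (Suc k)" if "R k V \<noteq> 0" for k V
      using freq[OF that] C by (simp add: distrib_right add_increasing)
  qed
qed

section \<open>Asymptotics at the rescaled point\<close>

text \<open>To first order in the phases the sum is \<open>n + \<i> (u / n\<^sup>2) n (n - 1) / 2\<close>. The quadratic remainders
  add up to at most \<open>n (u / n)\<^sup>2\<close>, and replacing \<open>n (n - 1)\<close> by \<open>n\<^sup>2\<close> costs at most \<open>\<bar>u\<bar> / n\<close>.\<close>

lemma phase_sum_error: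
  assumes n: "0 < n"
  shows "norm ((\<Sum>l<n. E (real l * (u / (real n)\<^sup>2))) - of_nat n - \<i> * of_real u / 2)
           \<le> (u\<^sup>2 + \<bar>u\<bar>) / real n"
proof -
  define h where "h = u / (real n)\<^sup>2"
  have gauss: "(\<Sum>l<n. real l) = real n * (real n - 1) / 2" for n
    by (induction n) (auto simp: field_simps)
  have "h * (\<Sum>l<n. real l) = u / 2 - u / (2 * real n)"
    using n unfolding gauss h_def by (simp add: power2_eq_square field_simps)
  moreover have "(\<Sum>l<n. \<i> * complex_of_real (real l * h)) = \<i> * of_real (h * (\<Sum>l<n. real l))"
    by (simp add: sum_distrib_left sum_distrib_right mult_ac)
  ultimately have lin: "(\<Sum>l<n. \<i> * complex_of_real (real l * h)) = \<i> * of_real (u / 2 - u / (2 * real n))"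
    by simp
  have quad: "norm (E x - (1 + \<i> * of_real x)) \<le> x\<^sup>2" for x
    using Taylor_exp[of "\<i> * of_real x" 1] by (simp add: E_def norm_mult power2_eq_square)
  have "norm (\<Sum>l<n. E (real l * h) - (1 + \<i> * of_real (real l * h))) \<le> (\<Sum>l<n. (u / real n)\<^sup>2)"
  proof (rule sum_norm_le)
    fix l assume "l \<in> {..<n}"
    then have "\<bar>real l * h\<bar> \<le> real n * \<bar>h\<bar>" by (simp add: abs_mult mult_right_mono)
    also have "\<dots> = \<bar>u / real n\<bar>" using n by (simp add: h_def power2_eq_square abs_mult)
    finally have "(real l * h)\<^sup>2 \<le> (u / real n)\<^sup>2" by (simp only: abs_le_square_iff)
    then show "norm (E (real l * h) - (1 + \<i> * of_real (real l * h))) \<le> (u / real n)\<^sup>2"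
      using quad order_trans by blast
  qed
  also have "\<dots> = u\<^sup>2 / real n" using n by (simp add: power2_eq_square)
  also have "(\<Sum>l<n. E (real l * h) - (1 + \<i> * of_real (real l * h)))
      = (\<Sum>l<n. E (real l * h)) - of_nat n - \<i> * of_real (u / 2 - u / (2 * real n))"
    unfolding sum_subtractf sum.distrib lin by simp
  finally have "norm ((\<Sum>l<n. E (real l * h)) - of_nat n - \<i> * of_real (u / 2 - u / (2 * real n)))
      \<le> u\<^sup>2 / real n" .
  moreover have "norm (\<i> * complex_of_real (u / (2 * real n))) \<le> \<bar>u\<bar> / real n"
    using n by (simp add: norm_mult norm_divide field_simps)
  moreover have "(\<Sum>l<n. E (real l * h)) - of_nat n - \<i> * of_real u / 2 =
      ((\<Sum>l<n. E (real l * h)) - of_nat n - \<i> * of_real (u / 2 - u / (2 * real n)))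
      - \<i> * complex_of_real (u / (2 * real n))"
    by (simp add: algebra_simps)
  ultimately have "norm ((\<Sum>l<n. E (real l * h)) - of_nat n - \<i> * of_real u / 2)
      \<le> u\<^sup>2 / real n + \<bar>u\<bar> / real n"
    by (metis (no_types, lifting) add_mono norm_triangle_le_diff)
  then show ?thesis by (simp add: h_def add_divide_distrib)
qed

text \<open>The derivative as a limit along increments \<open>y / r\<close> with \<open>r \<rightarrow> \<infinity>\<close> and a direction \<open>y\<close> that varies too;
  the limiting direction may be 0.\<close>

lemma tendsto_difference_quotient:
  fixes a :: "'a::real_normed_vector \<Rightarrow> 'b::real_normed_vector" and r :: "'c \<Rightarrow> real"
  assumes a: "(a has_derivative D) (at X0)"
    and y: "(y \<longlongrightarrow> x) F" and r: "filterlim r at_top F"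
  shows "((\<lambda>z. r z *\<^sub>R (a (X0 + (1 / r z) *\<^sub>R y z) - a X0)) \<longlongrightarrow> D x) F"
proof -
  interpret D: bounded_linear D using a by (rule has_derivative_bounded_linear)
  \<comment> \<open>The relative error at increment \<open>h\<close>. Division by zero makes it 0 at \<open>h = 0\<close>, hence it is
    continuous there.\<close>
  define \<rho> where "\<rho> h = norm (a (X0 + h) - a X0 - D h) / norm h" for h
  have "(\<rho> \<longlongrightarrow> \<rho> 0) (at 0)"
    using a unfolding has_derivative_at \<rho>_def by simp
  then have \<rho>: "(\<rho> \<longlongrightarrow> \<rho> 0) (nhds 0)"
    by (simp add: tendsto_at_iff_tendsto_nhds)
  have "((\<lambda>z. (1 / r z) *\<^sub>R y z) \<longlongrightarrow> 0 *\<^sub>R x) F"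
    using tendsto_inverse_0_at_top[OF r] y by (intro tendsto_scaleR) (auto simp: inverse_eq_divide)
  then have "((\<lambda>z. \<rho> ((1 / r z) *\<^sub>R y z)) \<longlongrightarrow> \<rho> 0) F"
    by (intro filterlim_compose[OF \<rho>]) simp
  then have "((\<lambda>z. norm (y z) * \<rho> ((1 / r z) *\<^sub>R y z)) \<longlongrightarrow> norm x * 0) F"
    by (intro tendsto_mult tendsto_norm y) (simp add: \<rho>_def)
  then have "((\<lambda>z. norm (y z) * \<rho> ((1 / r z) *\<^sub>R y z)) \<longlongrightarrow> 0) F" by simp
  moreover have "\<forall>\<^sub>F z in F. norm (r z *\<^sub>R (a (X0 + (1 / r z) *\<^sub>R y z) - a X0) - D (y z))
      \<le> norm (y z) * \<rho> ((1 / r z) *\<^sub>R y z)"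
    using filterlim_at_top_dense[THEN iffD1, OF r, rule_format, of 0]
  proof eventually_elim
    case (elim z)
    let ?h = "(1 / r z) *\<^sub>R y z"
    have "D (y z) = r z *\<^sub>R D ?h" using elim by (simp add: D.scaleR)
    then have "norm (r z *\<^sub>R (a (X0 + ?h) - a X0) - D (y z)) = r z * norm (a (X0 + ?h) - a X0 - D ?h)"
      using elim by (simp add: scaleR_right_diff_distrib[symmetric])
    also have "\<dots> = norm (y z) * \<rho> ?h"
      using elim by (cases "y z = 0") (auto simp: \<rho>_def D.zero)
    finally show ?case by simp
  qed
  ultimately have "((\<lambda>z. r z *\<^sub>R (a (X0 + (1 / r z) *\<^sub>R y z) - a X0) - D (y z)) \<longlongrightarrow> 0) F"
    by (rule Lim_null_comparison[rotated])
  then have "((\<lambda>z. (r z *\<^sub>R (a (X0 + (1 / r z) *\<^sub>R y z) - a X0) - D (y z)) + D (y z)) \<longlongrightarrow> 0 + D x) F"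
    by (intro tendsto_add D.tendsto y)
  then show ?thesis by simp
qed

text \<open>The expansion of \<open>F\<^sub>k\<close> in powers of \<open>n\<close>, where \<open>n + T\<close> is the sum of phases.\<close>

lemma Im_product_expansion:
  fixes p0 q0 p q T :: complex and n :: real
  shows "Im ((p0 + (of_real n + T) * p) * cnj (q0 + (of_real n + T) * q)) =
    Im (p0 * cnj q0) + n * Im (p * cnj q0 + p0 * cnj q)
    + Im (T * p * cnj q0 + cnj T * p0 * cnj q)
    + (n\<^sup>2 + 2 * n * Re T + (norm T)\<^sup>2) * Im (p * cnj q)"
  unfolding cmod_power2 by (simp add: algebra_simps power2_eq_square)

text \<open>In the expansion above, \<open>Im (p cnj q)\<close> and \<open>Im (p cnj q0 + p0 cnj q)\<close> vanish at \<open>X0\<close> by the reality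
  assumptions. Hence at distance \<open>O(n\<^sup>-\<^sup>2)\<close> they are themselves \<open>O(n\<^sup>-\<^sup>2)\<close>: times \<open>n\<^sup>2\<close> the first tends
  to its derivative, times \<open>n\<close> the second tends to 0. What remains is the value of \<open>Im (p0 cnj q0)\<close>
  and the contribution of \<open>T \<rightarrow> \<i> (x \<bullet> m)/2\<close>.\<close>

lemma tendsto_rescaled_Im_product:
  fixes p0 q0 p q :: "'a::real_inner \<Rightarrow> complex" and m :: 'a
  assumes p0: "(p0 has_derivative p0') (at X0)" and q0: "(q0 has_derivative q0') (at X0)"
    and p: "(p has_derivative p') (at X0)" and q: "(q has_derivative q') (at X0)"
    and real: "p X0 \<in> \<real>" "q X0 \<in> \<real>" "p0 X0 * q X0 - p X0 * q0 X0 \<in> \<real>"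
    and y: "(y \<longlongrightarrow> x) F" and n: "filterlim n at_top F"
  defines "Y \<equiv> \<lambda>z. X0 + (1 / (real (n z))\<^sup>2) *\<^sub>R y z"
    and "s \<equiv> \<lambda>z. \<Sum>l<n z. E (real l * ((y z \<bullet> m) / (real (n z))\<^sup>2))"
  shows "((\<lambda>z. Im ((p0 (Y z) + s z * p (Y z)) * cnj (q0 (Y z) + s z * q (Y z)))) \<longlongrightarrow>
      Im (p0 X0 * cnj (q0 X0)) - (x \<bullet> m) / 2 * Re (p0 X0 * q X0 - p X0 * q0 X0)
      - Im (p X0 * q' x - p' x * q X0)) F"
proof -
  define T where "T z = s z - of_nat (n z)" for z
  have n_real: "filterlim (\<lambda>z. real (n z)) at_top F"
    by (rule filterlim_compose[OF filterlim_real_sequentially n])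
  have n_sq: "filterlim (\<lambda>z. (real (n z))\<^sup>2) at_top F"
    by (rule filterlim_pow_at_top[OF _ n_real]) simp
  have inv_n: "((\<lambda>z. 1 / real (n z)) \<longlongrightarrow> 0) F"
    using tendsto_inverse_0_at_top[OF n_real] by (simp add: inverse_eq_divide)
  have inv_n_sq: "((\<lambda>z. 1 / (real (n z))\<^sup>2) \<longlongrightarrow> 0) F"
    using tendsto_inverse_0_at_top[OF n_sq] by (simp add: inverse_eq_divide)
  have n_pos: "\<forall>\<^sub>F z in F. 0 < n z"
    using filterlim_at_top[THEN iffD1, OF n, rule_format, of 1] by eventually_elim simp
  have Y: "(Y \<longlongrightarrow> X0) F"
  proof -
    have "(Y \<longlongrightarrow> X0 + 0 *\<^sub>R x) F"
      unfolding Y_def by (intro tendsto_intros inv_n_sq y)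
    then show ?thesis by simp
  qed
  have at_Y: "((\<lambda>z. f (Y z)) \<longlongrightarrow> f X0) F" if "(f has_derivative f') (at X0)" for f' and f :: "'a \<Rightarrow> complex"
    using has_derivative_continuous[OF that] Y by (rule isCont_tendsto_compose)
  have T: "(T \<longlongrightarrow> \<i> * of_real (x \<bullet> m) / 2) F"
  proof -
    have "((\<lambda>z. ((y z \<bullet> m)\<^sup>2 + \<bar>y z \<bullet> m\<bar>) * (1 / real (n z))) \<longlongrightarrow> ((x \<bullet> m)\<^sup>2 + \<bar>x \<bullet> m\<bar>) * 0) F"
      by (intro tendsto_intros inv_n y)
    then have lim: "((\<lambda>z. ((y z \<bullet> m)\<^sup>2 + \<bar>y z \<bullet> m\<bar>) / real (n z)) \<longlongrightarrow> 0) F" by simp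
    have "((\<lambda>z. T z - \<i> * of_real (y z \<bullet> m) / 2) \<longlongrightarrow> 0) F"
    proof (rule Lim_null_comparison[OF _ lim])
      show "\<forall>\<^sub>F z in F. norm (T z - \<i> * of_real (y z \<bullet> m) / 2)
          \<le> ((y z \<bullet> m)\<^sup>2 + \<bar>y z \<bullet> m\<bar>) / real (n z)"
        using n_pos unfolding T_def s_def by eventually_elim (rule phase_sum_error)
    qed
    then have "((\<lambda>z. (T z - \<i> * of_real (y z \<bullet> m) / 2) + \<i> * of_real (y z \<bullet> m) / 2)
        \<longlongrightarrow> 0 + \<i> * of_real (x \<bullet> m) / 2) F"
      by (intro tendsto_intros y) auto
    then show ?thesis by simp
  qed
  \<comment> \<open>The coefficients of \<open>n\<^sup>2\<close> and of \<open>n\<close>.\<close>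
  define a where "a Z = Im (p Z * cnj (q Z))" for Z
  define b where "b Z = Im (p Z * cnj (q0 Z) + p0 Z * cnj (q Z))" for Z
  have a0: "a X0 = 0" and b0: "b X0 = 0"
    using real by (auto simp: a_def b_def complex_is_Real_iff algebra_simps)
  have da: "(a has_derivative (\<lambda>h. Im (p X0 * cnj (q' h) + p' h * cnj (q X0)))) (at X0)"
    unfolding a_def
    by (intro has_derivative_Im has_derivative_mult has_derivative_cnj p q)
  have db: "(b has_derivative (\<lambda>h. Im ((p X0 * cnj (q0' h) + p' h * cnj (q0 X0))
      + (p0 X0 * cnj (q' h) + p0' h * cnj (q X0))))) (at X0)"
    unfolding b_def
    by (intro has_derivative_Im has_derivative_add has_derivative_mult has_derivative_cnj p q p0 q0)
  have A: "((\<lambda>z. (real (n z))\<^sup>2 * a (Y z)) \<longlongrightarrow> Im (p X0 * cnj (q' x) + p' x * cnj (q X0))) F"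
    using tendsto_difference_quotient[OF da y n_sq] by (simp add: a0 Y_def)
  \<comment> \<open>This term carries only one factor \<open>n\<close>, so convergence of \<open>n\<^sup>2 b\<close> to any limit makes it vanish.\<close>
  obtain \<beta> where "((\<lambda>z. (real (n z))\<^sup>2 * b (Y z)) \<longlongrightarrow> \<beta>) F"
    using tendsto_difference_quotient[OF db y n_sq] by (simp add: b0 Y_def)
  then have B: "((\<lambda>z. 1 / real (n z) * ((real (n z))\<^sup>2 * b (Y z))) \<longlongrightarrow> 0 * \<beta>) F"
    by (intro tendsto_mult inv_n)
  have "((\<lambda>z. Im (p0 (Y z) * cnj (q0 (Y z))) + 1 / real (n z) * ((real (n z))\<^sup>2 * b (Y z))
      + Im (T z * p (Y z) * cnj (q0 (Y z)) + cnj (T z) * p0 (Y z) * cnj (q (Y z)))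
      + (1 + 2 * (1 / real (n z)) * Re (T z) + 1 / (real (n z))\<^sup>2 * (norm (T z))\<^sup>2)
          * ((real (n z))\<^sup>2 * a (Y z))) \<longlongrightarrow>
      Im (p0 X0 * cnj (q0 X0)) + 0 * \<beta>
      + Im (\<i> * of_real (x \<bullet> m) / 2 * p X0 * cnj (q0 X0)
            + cnj (\<i> * of_real (x \<bullet> m) / 2) * p0 X0 * cnj (q X0))
      + (1 + 2 * 0 * Re (\<i> * of_real (x \<bullet> m) / 2) + 0 * (norm (\<i> * of_real (x \<bullet> m) / 2))\<^sup>2)
          * Im (p X0 * cnj (q' x) + p' x * cnj (q X0))) F" (is "(?G \<longlongrightarrow> ?L) F")
    by (intro tendsto_add tendsto_mult tendsto_Im tendsto_Re tendsto_cnj tendsto_norm tendsto_power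
        tendsto_const A B T inv_n inv_n_sq at_Y[OF p0] at_Y[OF q0] at_Y[OF p] at_Y[OF q])
  note limit = this
  have L: "?L = Im (p0 X0 * cnj (q0 X0)) - (x \<bullet> m) / 2 * Re (p0 X0 * q X0 - p X0 * q0 X0)
      - Im (p X0 * q' x - p' x * q X0)"
    using real(1,2) by (simp add: complex_is_Real_iff field_simps)
  have "\<forall>\<^sub>F z in F. ?G z = Im ((p0 (Y z) + s z * p (Y z)) * cnj (q0 (Y z) + s z * q (Y z)))"
    using n_pos
  proof eventually_elim
    case (elim z)
    have "s z = of_real (real (n z)) + T z" by (simp add: T_def)
    then show ?case
      using elim unfolding a_def b_def
      by (simp only: Im_product_expansion) (simp add: field_simps power2_eq_square)
  qed
  with limit show ?thesis
    unfolding L by (rule Lim_transform_eventually)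
qed

section \<open>The rescaled sequence\<close>

lemma partial_of_has_derivative:
  assumes "(f has_derivative D) (at X)"
  shows "partial j f X = D (axis j 1)"
proof -
  interpret D: bounded_linear D using assms by (rule has_derivative_bounded_linear)
  have "((\<lambda>t. X + t *\<^sub>R axis j 1) has_derivative (\<lambda>t. t *\<^sub>R axis j 1)) (at 0)"
    by (auto intro!: derivative_eq_intros)
  then have "((\<lambda>t. f (X + t *\<^sub>R axis j 1)) has_derivative (\<lambda>t. D (t *\<^sub>R axis j 1))) (at 0)"
    by (rule has_derivative_compose) (simp add: assms)
  then show ?thesis
    by (intro partial_eqI) (simp add: has_vector_derivative_def D.scaleR)
qed

lemma G_seq_eq_exp_sum:
  assumes A: "finite A" "{V. P k V \<noteq> 0} \<subseteq> A" and B: "finite B" "{V. Q k V \<noteq> 0} \<subseteq> B"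
  shows "G_seq P Q X0 k = (\<lambda>X. Im (\<Sum>i\<in>A \<times> B.
      (of_int (P k (fst i)) * of_int (Q k (snd i)) * E (X0 \<bullet> (of_lattice (fst i) - of_lattice (snd i))))
      * E (X \<bullet> ((1 / (real k)\<^sup>2) *\<^sub>R (of_lattice (fst i) - of_lattice (snd i))))))"
proof
  fix X :: "real ^ 2"
  let ?Y = "(1 / (real k)\<^sup>2) *\<^sub>R X + X0"
  have summand: "of_int (P k V) * E (?Y \<bullet> of_lattice V) * (of_int (Q k W) * E (- (?Y \<bullet> of_lattice W))) =
      of_int (P k V) * of_int (Q k W) * E (X0 \<bullet> (of_lattice V - of_lattice W))
        * E (X \<bullet> ((1 / (real k)\<^sup>2) *\<^sub>R (of_lattice V - of_lattice W)))" for V W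
  proof -
    have "?Y \<bullet> of_lattice V + - (?Y \<bullet> of_lattice W) = X0 \<bullet> (of_lattice V - of_lattice W)
        + X \<bullet> ((1 / (real k)\<^sup>2) *\<^sub>R (of_lattice V - of_lattice W))"
      by (simp add: inner_add_left inner_diff_right diff_divide_distrib)
    then have "E (?Y \<bullet> of_lattice V) * E (- (?Y \<bullet> of_lattice W)) = E (X0 \<bullet> (of_lattice V - of_lattice W))
        * E (X \<bullet> ((1 / (real k)\<^sup>2) *\<^sub>R (of_lattice V - of_lattice W)))"
      by (simp only: E_add[symmetric])
    moreover have "of_int (P k V) * E (?Y \<bullet> of_lattice V) * (of_int (Q k W) * E (- (?Y \<bullet> of_lattice W)))
        = of_int (P k V) * of_int (Q k W) * (E (?Y \<bullet> of_lattice V) * E (- (?Y \<bullet> of_lattice W)))"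
      by (simp only: mult_ac)
    ultimately show ?thesis by (simp only: mult.assoc)
  qed
  have "trig_poly (P k) ?Y * cnj (trig_poly (Q k) ?Y) =
      (\<Sum>V\<in>A. \<Sum>W\<in>B. (of_int (P k V) * E (?Y \<bullet> of_lattice V)) * (of_int (Q k W) * E (- (?Y \<bullet> of_lattice W))))"
    by (simp add: trig_poly_eq_sum[OF A] trig_poly_eq_sum[OF B] cnj_E sum_product)
  also have "\<dots> = (\<Sum>i\<in>A \<times> B.
      (of_int (P k (fst i)) * of_int (Q k (snd i)) * E (X0 \<bullet> (of_lattice (fst i) - of_lattice (snd i))))
      * E (X \<bullet> ((1 / (real k)\<^sup>2) *\<^sub>R (of_lattice (fst i) - of_lattice (snd i)))))"
    unfolding sum.cartesian_product case_prod_beta by (rule sum.cong[OF refl]) (rule summand)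
  finally show "G_seq P Q X0 k X = Im (\<Sum>i\<in>A \<times> B.
      (of_int (P k (fst i)) * of_int (Q k (snd i)) * E (X0 \<bullet> (of_lattice (fst i) - of_lattice (snd i))))
      * E (X \<bullet> ((1 / (real k)\<^sup>2) *\<^sub>R (of_lattice (fst i) - of_lattice (snd i)))))"
    unfolding G_seq_def F_seq_def by (rule arg_cong)
qed

lemma smooth_G_seq:
  assumes "linear_growth M P" "linear_growth M Q"
  shows "smooth (G_seq P Q X0 k)"
  unfolding G_seq_eq_exp_sum[where P = P and Q = Q,
      OF linear_growth_finite_support[OF linear_growth_by_sharp[OF assms(1)]] order_refl
         linear_growth_finite_support[OF linear_growth_by_sharp[OF assms(2)]] order_refl]
  by (rule smooth_Im_exp_sum)

text \<open>The derivative of order \<open>m\<close> is at most mass times the \<open>m\<close>-th power of the largest frequency, here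
  \<open>(C n)\<^sup>2 (C / n)\<^sup>m\<close>, which stays bounded in \<open>n\<close> exactly when \<open>m \<ge> 2\<close>.\<close>

lemma G_seq_higher_partials_bounded:
  assumes P: "linear_growth M P" and Q: "linear_growth M Q" and js: "length js \<ge> 2"
  obtains C where "\<And>k X. norm (iter_partial js (G_seq P Q X0 (Suc k)) X) \<le> C"
proof -
  note P = linear_growth_by_sharp[OF P] and Q = linear_growth_by_sharp[OF Q]
  obtain C1 where C1: "C1 \<ge> 0"
    "\<And>k. (\<Sum>V | P k V \<noteq> 0. \<bar>real_of_int (P k V)\<bar>) \<le> C1 * real (Suc k)"
    "\<And>k V. P k V \<noteq> 0 \<Longrightarrow> norm (of_lattice V) \<le> C1 * real (Suc k)"
    using linear_growth_bounds[OF P] by blast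
  obtain C2 where C2: "C2 \<ge> 0"
    "\<And>k. (\<Sum>V | Q k V \<noteq> 0. \<bar>real_of_int (Q k V)\<bar>) \<le> C2 * real (Suc k)"
    "\<And>k V. Q k V \<noteq> 0 \<Longrightarrow> norm (of_lattice V) \<le> C2 * real (Suc k)"
    using linear_growth_bounds[OF Q] by blast
  \<comment> \<open>The factor 2 absorbs the shift from \<open>Suc (Suc k)\<close> to \<open>Suc k\<close>.\<close>
  define C where "C = 2 * (C1 + C2)"
  have C: "0 \<le> C" "2 * C1 \<le> C" "2 * C2 \<le> C" using C1(1) C2(1) by (auto simp: C_def)
  have "norm (iter_partial js (G_seq P Q X0 (Suc k)) X) \<le> C * C * C ^ length js" for k X
  proof -
    define n where "n = real (Suc k)"
    have n: "1 \<le> n" "real (Suc (Suc k)) \<le> 2 * n" by (auto simp: n_def)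
    let ?A = "{V. P (Suc k) V \<noteq> 0}" and ?B = "{V. Q (Suc k) V \<noteq> 0}"
    let ?c = "\<lambda>i. complex_of_int (P (Suc k) (fst i)) * of_int (Q (Suc k) (snd i))
        * E (X0 \<bullet> (of_lattice (fst i) - of_lattice (snd i)))"
    let ?w = "\<lambda>i. (1 / n\<^sup>2) *\<^sub>R (of_lattice (fst i) - of_lattice (snd i)) :: real ^ 2"
    have eq: "G_seq P Q X0 (Suc k) = (\<lambda>X. Im (\<Sum>i\<in>?A \<times> ?B. ?c i * E (X \<bullet> ?w i)))"
      unfolding n_def using linear_growth_finite_support[OF P] linear_growth_finite_support[OF Q]
      by (intro G_seq_eq_exp_sum) auto
    have mass_P: "(\<Sum>V\<in>?A. \<bar>real_of_int (P (Suc k) V)\<bar>) \<le> C * n"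
    proof -
      have "C1 * real (Suc (Suc k)) \<le> C1 * (2 * n)" using C1(1) n by (intro mult_left_mono)
      also have "\<dots> \<le> C * n" using C n by (simp add: mult_right_mono)
      finally show ?thesis using C1(2)[of "Suc k"] by linarith
    qed
    have mass_Q: "(\<Sum>V\<in>?B. \<bar>real_of_int (Q (Suc k) V)\<bar>) \<le> C * n"
    proof -
      have "C2 * real (Suc (Suc k)) \<le> C2 * (2 * n)" using C2(1) n by (intro mult_left_mono)
      also have "\<dots> \<le> C * n" using C n by (simp add: mult_right_mono)
      finally show ?thesis using C2(2)[of "Suc k"] by linarith
    qed
    have "(\<Sum>i\<in>?A \<times> ?B. norm (?c i)) =
        (\<Sum>V\<in>?A. \<bar>real_of_int (P (Suc k) V)\<bar>) * (\<Sum>V\<in>?B. \<bar>real_of_int (Q (Suc k) V)\<bar>)"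
      by (simp add: sum_product sum.cartesian_product norm_mult case_prod_beta)
    also have "\<dots> \<le> (C * n) * (C * n)"
      using mass_P mass_Q C n by (intro mult_mono) (auto intro: sum_nonneg)
    finally have mass: "(\<Sum>i\<in>?A \<times> ?B. norm (?c i)) \<le> (C * n) * (C * n)" .
    have freq: "norm (?w i) \<le> C / n" if "i \<in> ?A \<times> ?B" for i
    proof -
      have "norm (of_lattice (fst i) - of_lattice (snd i) :: real ^ 2)
          \<le> norm (of_lattice (fst i) :: real ^ 2) + norm (of_lattice (snd i) :: real ^ 2)"
        by (rule norm_triangle_ineq4)
      also have "\<dots> \<le> C1 * real (Suc (Suc k)) + C2 * real (Suc (Suc k))"
        using that by (intro add_mono C1(3) C2(3)) auto
      also have "\<dots> = (C1 + C2) * real (Suc (Suc k))" by (rule distrib_right[symmetric])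
      also have "\<dots> \<le> (C1 + C2) * (2 * n)"
        using C1(1) C2(1) n by (intro mult_left_mono) auto
      finally have "norm (of_lattice (fst i) - of_lattice (snd i) :: real ^ 2) \<le> C * n"
        by (simp add: C_def mult_ac)
      then have "norm (?w i) \<le> (1 / n\<^sup>2) * (C * n)"
        by (simp add: divide_right_mono)
      also have "\<dots> = C / n" using n by (simp add: power2_eq_square)
      finally show ?thesis .
    qed
    have "norm (iter_partial js (G_seq P Q X0 (Suc k)) X) \<le> (\<Sum>i\<in>?A \<times> ?B. norm (?c i)) * (C / n) ^ length js"
      unfolding eq by (rule norm_iter_partial_Im_exp_sum_le) (rule freq)
    also have "\<dots> \<le> ((C * n) * (C * n)) * (C / n) ^ length js"
      using mass C n by (intro mult_right_mono) auto
    also have "\<dots> = (C * C * C ^ length js) * (n\<^sup>2 / n ^ length js)"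
      by (simp add: power_divide power2_eq_square)
    also have "\<dots> \<le> (C * C * C ^ length js) * 1"
      using C n js by (intro mult_left_mono) (auto simp: divide_le_eq_1 power_increasing)
    finally show ?thesis by simp
  qed
  then show thesis by (rule that)
qed

text \<open>The numerator \<open>t = p1 q2 M\<^sub>1 + p2 q1 M\<^sub>2\<close> satisfies \<open>X0 \<bullet> M = 2 \<pi> t / (q1 q2)\<close>. As \<open>gcd q1 q2\<close>
  divides \<open>t\<close>, vanishing of \<open>\<phi>\<close> means that \<open>q1 q2\<close> divides \<open>t\<close>.\<close>

lemma phase_trivial_on_kernel:
  assumes q: "q1 \<ge> 1" "q2 \<ge> 1"
    and X0: "X0 = (2 * pi) *\<^sub>R vector [real_of_int p1 / real_of_int q1, real_of_int p2 / real_of_int q2]"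
    and M: "phi p1 p2 q1 q2 M = 0"
  shows "E (real l * (X0 \<bullet> of_lattice M)) = 1"
proof -
  let ?g = "gcd q1 q2" and ?t = "p1 * q2 * M $ 1 + p2 * q1 * M $ 2"
  have "(q1 * q2) div ?g dvd ?t div ?g"
    using M by (simp add: phi_def modulus_N_def mod_eq_0_iff_dvd)
  then have "(q1 * q2) div ?g * ?g dvd ?t div ?g * ?g" by (rule mult_dvd_mono) simp
  moreover have "?g dvd q1 * q2" "?g dvd ?t" by (auto intro!: dvd_add)
  then have "(q1 * q2) div ?g * ?g = q1 * q2" "?t div ?g * ?g = ?t"
    by (simp_all only: dvd_div_mult_self)
  ultimately have "q1 * q2 dvd ?t" by (simp only:)
  then obtain c where c: "?t = q1 * q2 * c" ..
  have "X0 \<bullet> of_lattice M = 2 * pi * (real_of_int ?t / (real_of_int q1 * real_of_int q2))"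
    using q by (simp add: X0 inner_vec_def sum_2 of_lattice_def field_simps)
  also have "\<dots> = 2 * pi * real_of_int c" unfolding c using q by simp
  finally show ?thesis
    using E_integer_multiple_2pi[of "int l * c"] by (simp add: mult_ac)
qed

lemma F_seq_linear_growth:
  assumes P: "linear_growth M P" and Q: "linear_growth M Q"
    and X0: "\<And>l. E (real l * (X0 \<bullet> of_lattice M)) = 1"
  shows "F_seq P Q X0 k X =
    Im ((trig_poly (P 0) (X0 + X) + (\<Sum>l<k. E (real l * (X \<bullet> of_lattice M))) * trig_poly (sharp M P) (X0 + X))
      * cnj (trig_poly (Q 0) (X0 + X) + (\<Sum>l<k. E (real l * (X \<bullet> of_lattice M))) * trig_poly (sharp M Q) (X0 + X)))"
proof -
  have "E (real l * ((X0 + X) \<bullet> of_lattice M)) = E (real l * (X \<bullet> of_lattice M))" for l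
    by (simp add: inner_add_left distrib_left E_add X0)
  then show ?thesis
    by (simp add: F_seq_def add.commute[of X] trig_poly_linear_growth[OF linear_growth_by_sharp[OF P], of k]
        trig_poly_linear_growth[OF linear_growth_by_sharp[OF Q], of k])
qed

theorem theorem6p1:
  fixes p1 p2 q1 q2 :: int
    and X0 :: "real ^ 2"
    and M :: "int ^ 2"
    and P Q :: "nat \<Rightarrow> int ^ 2 \<Rightarrow> int"
  assumes "q1 \<ge> 1" and "q2 \<ge> 1"
    and "X0 = (2 * pi) *\<^sub>R vector [real_of_int p1 / real_of_int q1, real_of_int p2 / real_of_int q2]"
    and "phi p1 p2 q1 q2 M = 0"
    and "linear_growth M P" and "linear_growth M Q"
    and "trig_poly (sharp M P) X0 \<in> \<real>"
    and "trig_poly (sharp M Q) X0 \<in> \<real>"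
    and "delta M P Q X0 \<in> \<real>"
  shows "converges_Cinf (\<lambda>k. G_seq P Q X0 (Suc k))
    (\<lambda>X. F_seq P Q X0 0 0 - Delta M P Q X0 1 * X $ 1 - Delta M P Q X0 2 * X $ 2)"
proof -
  let ?G = "\<lambda>X :: real ^ 2. F_seq P Q X0 0 0 - Delta M P Q X0 1 * X $ 1 - Delta M P Q X0 2 * X $ 2"
  let ?a = "trig_poly (P 0)" and ?b = "trig_poly (Q 0)"
    and ?p = "trig_poly (sharp M P)" and ?q = "trig_poly (sharp M Q)"
  let ?m = "of_lattice M"
  note growth = linear_growth_by_sharp[OF assms(5)] linear_growth_by_sharp[OF assms(6)]
  have fin: "finite {V. P 0 V \<noteq> 0}" "finite {V. Q 0 V \<noteq> 0}"
    "finite {V. sharp M P V \<noteq> 0}" "finite {V. sharp M Q V \<noteq> 0}"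
    using growth by (auto simp: linear_growth_by_def)
  obtain p0' where p0': "(?a has_derivative p0') (at X0)" by (rule trig_poly_has_derivative[OF fin(1)])
  obtain q0' where q0': "(?b has_derivative q0') (at X0)" by (rule trig_poly_has_derivative[OF fin(2)])
  obtain p' where p': "(?p has_derivative p') (at X0)" by (rule trig_poly_has_derivative[OF fin(3)])
  obtain q' where q': "(?q has_derivative q') (at X0)" by (rule trig_poly_has_derivative[OF fin(4)])
  have delta: "delta M P Q X0 = ?a X0 * ?q X0 - ?p X0 * ?b X0"
    by (simp add: delta_def det_2)
  have delta_part: "delta_part M P Q X0 j = ?p X0 * q' (axis j 1) - p' (axis j 1) * ?q X0" for j
    by (simp add: delta_part_def det_2 partial_of_has_derivative[OF p'] partial_of_has_derivative[OF q'])
  have coordinates: "D x = x $ 1 *\<^sub>R D (axis 1 1) + x $ 2 *\<^sub>R D (axis 2 1)"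
    if "(f has_derivative D) (at X0)" for f and x :: "real ^ 2" and D :: "real ^ 2 \<Rightarrow> complex"
  proof -
    interpret D: bounded_linear D using that by (rule has_derivative_bounded_linear)
    have "x = x $ 1 *\<^sub>R axis 1 1 + x $ 2 *\<^sub>R axis 2 1"
      by (simp add: vec_eq_iff forall_2 axis_def)
    then show ?thesis by (metis D.add D.scaleR)
  qed
  have G_eq: "?G x = Im (?a X0 * cnj (?b X0)) - (x \<bullet> ?m) / 2 * Re (?a X0 * ?q X0 - ?p X0 * ?b X0)
      - Im (?p X0 * q' x - p' x * ?q X0)" for x
  proof -
    have "?p X0 * q' x - p' x * ?q X0 =
        x $ 1 *\<^sub>R delta_part M P Q X0 1 + x $ 2 *\<^sub>R delta_part M P Q X0 2"
      unfolding coordinates[OF p', of x] coordinates[OF q', of x] delta_part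
      by (simp add: algebra_simps scaleR_conv_of_real)
    moreover have "x \<bullet> ?m = x $ 1 * real_of_int (M $ 1) + x $ 2 * real_of_int (M $ 2)"
      by (simp add: inner_vec_def sum_2 of_lattice_def)
    ultimately show ?thesis
      unfolding Delta_def delta[symmetric]
      by (simp add: F_seq_def algebra_simps)
  qed
  have affine: "?G = (\<lambda>X. F_seq P Q X0 0 0 + vector [- Delta M P Q X0 1, - Delta M P Q X0 2] \<bullet> X)"
    by (rule ext) (simp add: inner_vec_def sum_2)
  have rescale: "((1 / r) *\<^sub>R y) \<bullet> ?m = (y \<bullet> ?m) / r" for r and y :: "real ^ 2"
    by simp
  show ?thesis
  proof (rule converges_CinfI)
    show "smooth (G_seq P Q X0 (Suc k))" for k
      by (rule smooth_G_seq[OF assms(5,6)])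
    show "smooth ?G" unfolding affine by (rule smooth_affine)
    show "\<exists>B. \<forall>k. \<forall>X\<in>K. norm (iter_partial js (G_seq P Q X0 (Suc k)) X) \<le> B"
      if "length js \<ge> 2" for js K
      using G_seq_higher_partials_bounded[OF assms(5,6) that] by metis
    show "uniform_limit K (\<lambda>k. G_seq P Q X0 (Suc k)) ?G sequentially" if "compact K" for K
    proof (rule uniform_limit_of_joint_limits[OF that])
      fix x :: "real ^ 2"
      show "isCont ?G x" unfolding affine by (intro continuous_intros)
      have "filterlim (\<lambda>z. Suc (fst z)) at_top (sequentially \<times>\<^sub>F nhds x)"
        by (rule filterlim_compose[OF filterlim_Suc filterlim_fst])
      then have "((\<lambda>z. F_seq P Q X0 (Suc (fst z)) ((1 / (real (Suc (fst z)))\<^sup>2) *\<^sub>R snd z)) \<longlongrightarrow> ?G x)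
          (sequentially \<times>\<^sub>F nhds x)"
        unfolding G_eq unfolding F_seq_linear_growth[OF assms(5,6) phase_trivial_on_kernel[OF assms(1-4)]] rescale
        by (rule tendsto_rescaled_Im_product[OF p0' q0' p' q' assms(7,8) assms(9)[unfolded delta] filterlim_snd])
      then show "((\<lambda>(k, y). G_seq P Q X0 (Suc k) y) \<longlongrightarrow> ?G x) (sequentially \<times>\<^sub>F nhds x)"
        by (simp only: G_seq_def case_prod_unfold)
    qed
  qed
qed

end
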